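(* (i) Let $w\in A^*$. A column $\gamma$ satisfies $w\cdot\gamma=\gamma$ if and only if $\mathrm{Supp}(w)\subseteq\gamma$. (ii) The support of a word $w$ is the smallest, for inclusion, column fixed by the action of $w$. (iii) The idempotents of $\mathrm{Styl}(A)$ are exactly the images under $\mu$ of the strictly decreasing words. (iv) $\mathrm{Styl}(A)$ has exactly $2^{|A|}$ idempotents.
   Context: $A$ is a finite totally ordered alphabet, $A^*$ the free monoid, and $\mathrm{Supp}(w)$ the set of letters occurring in $w$. A column is a subset of $A$, identified with the strictly decreasing word of its elements. For a column $\gamma$ and a letter $x$: if $x>y$ for all $y\in\gamma$, $x\cdot\gamma=\gamma\cup\{x\}$; otherwise with $y$ the smallest element of $\gamma$ with $y\geq x$, $x\cdot\gamma=(\gamma\setminus\{y\})\cup\{x\}$; this extends to a left action of $A^*$ on the set of columns by $(uv)\cdot\gamma=u\cdot(v\cdot\gamma)$. $\mathrm{Styl}(A)$ is the monoid of maps on columns induced by words under this action and $\mu:A^*\to\mathrm{Styl}(A)$ the canonical surjective homomorphism. *)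

theory Defs
  imports "HOL-Algebra.Group" "HOL-Library.FuncSet"
begin

text \<open>
  The alphabet is a finite set \<open>A\<close> of elements of a linearly ordered type (so the empty alphabet
  is included), words are the elements of \<open>lists A\<close>, the support of a word \<open>w\<close> is \<open>set w\<close>, and a
  column is represented by its set of letters.
\<close>

definition columns :: "'a set \<Rightarrow> 'a set set" where
  "columns A = Pow A"

definition letter_act :: "'a::linorder \<Rightarrow> 'a set \<Rightarrow> 'a set" where
  "letter_act x \<gamma> =
     (if \<forall>y\<in>\<gamma>. y < x then \<gamma> \<union> {x}
      else (\<gamma> - {Min {y \<in> \<gamma>. x \<le> y}}) \<union> {x})"

text \<open>Left action: the last letter of the word acts first.\<close>

definition word_act :: "'a::linorder list \<Rightarrow> 'a set \<Rightarrow> 'a set" where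
  "word_act w \<gamma> = foldr letter_act w \<gamma>"

lemma word_act_Nil: "word_act [] \<gamma> = \<gamma>"
  by (simp add: word_act_def)

lemma word_act_singleton: "word_act [x] \<gamma> = letter_act x \<gamma>"
  by (simp add: word_act_def)

lemma word_act_append: "word_act (u @ v) \<gamma> = word_act u (word_act v \<gamma>)"
  by (simp add: word_act_def)

lemma letter_act_column:
  assumes "x \<in> A" "\<gamma> \<in> columns A"
  shows "letter_act x \<gamma> \<in> columns A"
  using assms by (auto simp: columns_def letter_act_def)

lemma word_act_column:
  assumes "w \<in> lists A" "\<gamma> \<in> columns A"
  shows "word_act w \<gamma> \<in> columns A"
  using assms(1)
  by (induction w) (use assms(2) in \<open>auto simp: word_act_def intro: letter_act_column\<close>)

text \<open>
  Maps on columns are made extensional, so that two words have the same image exactly when they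
  act in the same way on the columns over \<open>A\<close>.
\<close>

definition styl_map :: "'a::linorder set \<Rightarrow> 'a list \<Rightarrow> 'a set \<Rightarrow> 'a set" where
  "styl_map A w = (\<lambda>\<gamma>\<in>columns A. word_act w \<gamma>)"

definition Styl :: "'a::linorder set \<Rightarrow> ('a set \<Rightarrow> 'a set) monoid" where
  "Styl A =
     \<lparr>carrier = styl_map A ` lists A,
      mult = (\<lambda>f g. compose (columns A) f g),
      one = (\<lambda>\<gamma>\<in>columns A. \<gamma>)\<rparr>"

lemma styl_map_Nil: "styl_map A [] = \<one>\<^bsub>Styl A\<^esub>"
  by (simp add: styl_map_def Styl_def word_act_Nil)

lemma styl_map_append:
  assumes "v \<in> lists A"
  shows "styl_map A (u @ v) = styl_map A u \<otimes>\<^bsub>Styl A\<^esub> styl_map A v"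
proof
  fix \<gamma>
  show "styl_map A (u @ v) \<gamma> = (styl_map A u \<otimes>\<^bsub>Styl A\<^esub> styl_map A v) \<gamma>"
    using word_act_column[OF assms, of \<gamma>]
    by (simp add: styl_map_def Styl_def compose_def word_act_append)
qed

lemma carrier_Styl: "carrier (Styl A) = styl_map A ` lists A"
  by (simp add: Styl_def)

lemma monoid_Styl: "monoid (Styl A)"
proof (rule monoidI; (elim imageE[of _ "styl_map A" "lists A", folded carrier_Styl])?)
  show "\<one>\<^bsub>Styl A\<^esub> \<in> carrier (Styl A)"
    by (metis carrier_Styl image_eqI lists.Nil styl_map_Nil)
next
  fix f g u v
  assume "f = styl_map A u" "u \<in> lists A" "g = styl_map A v" "v \<in> lists A"
  then show "f \<otimes>\<^bsub>Styl A\<^esub> g \<in> carrier (Styl A)"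
    by (metis append_in_lists_conv carrier_Styl image_eqI styl_map_append)
next
  fix f g h u v w
  assume "f = styl_map A u" "u \<in> lists A" "g = styl_map A v" "v \<in> lists A"
    "h = styl_map A w" "w \<in> lists A"
  then show "f \<otimes>\<^bsub>Styl A\<^esub> g \<otimes>\<^bsub>Styl A\<^esub> h = f \<otimes>\<^bsub>Styl A\<^esub> (g \<otimes>\<^bsub>Styl A\<^esub> h)"
    by (metis append.assoc append_in_lists_conv styl_map_append)
next
  fix f u
  assume "f = styl_map A u" "u \<in> lists A"
  then show "\<one>\<^bsub>Styl A\<^esub> \<otimes>\<^bsub>Styl A\<^esub> f = f"
    by (metis append_Nil styl_map_Nil styl_map_append)
next
  fix f u
  assume "f = styl_map A u" "u \<in> lists A"
  then show "f \<otimes>\<^bsub>Styl A\<^esub> \<one>\<^bsub>Styl A\<^esub> = f"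
    by (metis append_Nil2 lists.Nil styl_map_Nil styl_map_append)
qed

definition idempotents :: "('b, 'c) monoid_scheme \<Rightarrow> 'b set" where
  "idempotents M = {e \<in> carrier M. e \<otimes>\<^bsub>M\<^esub> e = e}"

end

theory Submission
  imports Defs
begin

text \<open>
  Order columns by comparing, for every letter \<open>z\<close>, their numbers of letters \<open>\<le> z\<close>. The action of a
  word is monotone and extensive for this order, so an idempotent of the stylic monoid is a closure
  operator and is determined by its fixed points. By extensivity, a column is fixed by a word iff it
  is fixed by each of its letters, i.e. iff it contains them. Hence an idempotent is determined by
  its support. A strictly decreasing word inserts its letters in increasing order, so no letter is
  bumped by a later one; its action therefore produces a column containing its support, and is
  idempotent.
\<close>

section \<open>The domination order on columns\<close>

definition dominated :: "'a::linorder set \<Rightarrow> 'a set \<Rightarrow> bool" where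
  "dominated \<gamma> \<delta> \<longleftrightarrow> (\<forall>z. card {y \<in> \<gamma>. y \<le> z} \<le> card {y \<in> \<delta>. y \<le> z})"

lemma dominated_refl: "dominated \<gamma> \<gamma>"
  by (simp add: dominated_def)

lemma dominated_trans: "dominated \<gamma> \<delta> \<Longrightarrow> dominated \<delta> \<epsilon> \<Longrightarrow> dominated \<gamma> \<epsilon>"
  unfolding dominated_def using le_trans by blast

lemma dominated_strict:
  assumes "finite \<gamma>" "finite \<delta>" "dominated \<gamma> \<delta>"
  shows "card {y \<in> \<gamma>. y < x} \<le> card {y \<in> \<delta>. y < x}"
proof (cases "{y \<in> \<gamma>. y < x} = {}")
  case True
  then show ?thesis by (metis card.empty zero_le)
next
  case False
  \<comment> \<open>In a general linear order \<open>x\<close> may have no predecessor, so the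
    threshold is the last letter of \<gamma> below \<open>x\<close>: the count for \<gamma> is then
    exact, and the count for \<delta> can only shrink.\<close>
  define z where "z = Max {y \<in> \<gamma>. y < x}"
  have fin: "finite {y \<in> \<gamma>. y < x}"
    using assms(1) by simp
  have z: "z < x"
    using Max_in[OF fin False] by (simp add: z_def)
  have "{y \<in> \<gamma>. y < x} = {y \<in> \<gamma>. y \<le> z}"
    using z Max_ge[OF fin] by (auto simp: z_def)
  then have "card {y \<in> \<gamma>. y < x} \<le> card {y \<in> \<delta>. y \<le> z}"
    using assms(3) by (simp add: dominated_def)
  also have "\<dots> \<le> card {y \<in> \<delta>. y < x}"
    using z assms(2) by (intro card_mono) auto
  finally show ?thesis .
qed

text \<open>The counting function of a column jumps exactly at its letters. The counts thus
  determine the column, which yields antisymmetry of domination.\<close>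

lemma mem_iff_card_less:
  fixes x :: "'a::linorder"
  assumes "finite \<gamma>"
  shows "x \<in> \<gamma> \<longleftrightarrow> card {y \<in> \<gamma>. y < x} < card {y \<in> \<gamma>. y \<le> x}"
proof
  assume "x \<in> \<gamma>"
  then have "{y \<in> \<gamma>. y < x} \<subset> {y \<in> \<gamma>. y \<le> x}" by auto
  then show "card {y \<in> \<gamma>. y < x} < card {y \<in> \<gamma>. y \<le> x}"
    using assms by (intro psubset_card_mono) auto
next
  assume less: "card {y \<in> \<gamma>. y < x} < card {y \<in> \<gamma>. y \<le> x}"
  show "x \<in> \<gamma>"
  proof (rule ccontr)
    assume "x \<notin> \<gamma>"
    then have "{y \<in> \<gamma>. y < x} = {y \<in> \<gamma>. y \<le> x}" by (auto simp: order.order_iff_strict)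
    with less show False by simp
  qed
qed

lemma dominated_antisym:
  assumes "finite \<gamma>" "finite \<delta>" "dominated \<gamma> \<delta>" "dominated \<delta> \<gamma>"
  shows "\<gamma> = \<delta>"
proof (rule Set.set_eqI)
  fix x
  have "card {y \<in> \<gamma>. y < x} = card {y \<in> \<delta>. y < x}"
    using assms by (intro order.antisym dominated_strict)
  moreover have "card {y \<in> \<gamma>. y \<le> x} = card {y \<in> \<delta>. y \<le> x}"
    using assms(3,4) unfolding dominated_def by (intro order.antisym) blast+
  ultimately show "x \<in> \<gamma> \<longleftrightarrow> x \<in> \<delta>"
    using mem_iff_card_less[OF assms(1), of x] mem_iff_card_less[OF assms(2), of x] by simp
qed

section \<open>Action of a single letter\<close>

lemma letter_act_cases:
  assumes "finite \<gamma>"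
  obtains (add) "\<And>y. y \<in> \<gamma> \<Longrightarrow> y < x" "letter_act x \<gamma> = insert x \<gamma>"
  | (bump) m where "m \<in> \<gamma>" "x \<le> m" "\<And>y. y \<in> \<gamma> \<Longrightarrow> x \<le> y \<Longrightarrow> m \<le> y"
      "letter_act x \<gamma> = insert x (\<gamma> - {m})"
proof (cases "\<forall>y\<in>\<gamma>. y < x")
  case True
  then show ?thesis by (intro add) (auto simp: letter_act_def)
next
  case False
  define m where "m = Min {y \<in> \<gamma>. x \<le> y}"
  have fin: "finite {y \<in> \<gamma>. x \<le> y}"
    using assms by simp
  have ne: "{y \<in> \<gamma>. x \<le> y} \<noteq> {}"
    using False by (auto simp: not_less)
  have "m \<in> \<gamma>" "x \<le> m"
    using Min_in[OF fin ne] by (simp_all add: m_def)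
  moreover have "m \<le> y" if "y \<in> \<gamma>" "x \<le> y" for y
    unfolding m_def using fin that by (intro Min_le) auto
  moreover have "letter_act x \<gamma> = insert x (\<gamma> - {m})"
    using False by (auto simp: letter_act_def m_def)
  ultimately show ?thesis by (rule bump)
qed

lemma finite_letter_act: "finite \<gamma> \<Longrightarrow> finite (letter_act x \<gamma>)"
  by (simp add: letter_act_def)

lemma letter_in_letter_act: "x \<in> letter_act x \<gamma>"
  by (simp add: letter_act_def)

lemma letter_act_keeps_smaller:
  assumes "finite \<gamma>" "y \<in> \<gamma>" "y < x"
  shows "y \<in> letter_act x \<gamma>"
  using assms(1) by (cases rule: letter_act_cases[where x = x]) (use assms in auto)

text \<open>A letter already present is the least candidate for bumping, so it bumps itself.\<close>

lemma letter_act_fixed: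
  assumes "finite \<gamma>" "x \<in> \<gamma>"
  shows "letter_act x \<gamma> = \<gamma>"
  using assms(1)
proof (cases rule: letter_act_cases[where x = x])
  case add
  with assms(2) show ?thesis by blast
next
  case (bump m)
  then have "m = x" using assms(2) by (intro order.antisym) simp_all
  with bump show ?thesis by auto
qed

text \<open>Counts change only for thresholds \<open>z\<close> from \<open>x\<close> up to just
  before the bumped letter, or for all \<open>z\<close> from \<open>x\<close> on if nothing is
  bumped. There \<gamma> has no letter between \<open>x\<close> and \<open>z\<close>, so the old
  count is the number of letters below \<open>x\<close>, and it grows by one. Past the bumped letter
  the old count already exceeds that number, so the \<open>max\<close> leaves it alone. The new
  counts are thus monotone in the old ones, which gives extensivity and monotonicity.\<close>

lemma card_letter_act:
  assumes "finite \<gamma>"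
  shows "card {y \<in> letter_act x \<gamma>. y \<le> z} =
    (if z < x then card {y \<in> \<gamma>. y \<le> z}
     else max (card {y \<in> \<gamma>. y \<le> z}) (Suc (card {y \<in> \<gamma>. y < x})))"
  using assms
proof (cases rule: letter_act_cases[where x = x])
  case add
  show ?thesis
  proof (cases "z < x")
    case True
    then have "{y \<in> letter_act x \<gamma>. y \<le> z} = {y \<in> \<gamma>. y \<le> z}"
      using add by auto
    with True show ?thesis by simp
  next
    case False
    then have "{y \<in> letter_act x \<gamma>. y \<le> z} = insert x \<gamma>" "{y \<in> \<gamma>. y \<le> z} = \<gamma>"
      "{y \<in> \<gamma>. y < x} = \<gamma>" "x \<notin> \<gamma>"
      using add by fastforce+
    with False assms show ?thesis by simp
  qed
next
  case (bump m)
  consider "z < x" | "x \<le> z" "z < m" | "x \<le> z" "m \<le> z" by fastforce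
  then show ?thesis
  proof cases
    case 1
    then have "{y \<in> letter_act x \<gamma>. y \<le> z} = {y \<in> \<gamma>. y \<le> z}"
      using bump by auto
    with 1 show ?thesis by simp
  next
    case 2
    then have "{y \<in> letter_act x \<gamma>. y \<le> z} = insert x {y \<in> \<gamma>. y < x}"
      "{y \<in> \<gamma>. y \<le> z} = {y \<in> \<gamma>. y < x}"
      using bump by fastforce+
    with 2 assms show ?thesis by simp
  next
    case 3
    then have "{y \<in> letter_act x \<gamma>. y \<le> z} = insert x ({y \<in> \<gamma>. y \<le> z} - {m})"
      using bump by auto
    moreover have "x \<notin> {y \<in> \<gamma>. y \<le> z} - {m}"
      using bump by force
    moreover have "m \<in> {y \<in> \<gamma>. y \<le> z}"
      using bump 3 by simp
    \<comment> \<open>Here \<open>x\<close> and \<open>m\<close> both lie within the threshold: one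
      letter enters and one leaves. This includes the case \<open>m = x\<close>.\<close>
    ultimately have eq: "card {y \<in> letter_act x \<gamma>. y \<le> z} = card {y \<in> \<gamma>. y \<le> z}"
      using assms card_Suc_Diff1[of "{y \<in> \<gamma>. y \<le> z}" m] by simp
    have "m \<notin> {y \<in> \<gamma>. y < x}"
      using bump by simp
    moreover have "{y \<in> \<gamma>. y < x} \<subseteq> {y \<in> \<gamma>. y \<le> z}"
      using 3 by auto
    ultimately have "{y \<in> \<gamma>. y < x} \<subset> {y \<in> \<gamma>. y \<le> z}"
      using \<open>m \<in> {y \<in> \<gamma>. y \<le> z}\<close> by blast
    then have "card {y \<in> \<gamma>. y < x} < card {y \<in> \<gamma>. y \<le> z}"
      using assms by (intro psubset_card_mono) auto
    with eq 3 show ?thesis by simp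
  qed
qed

lemma letter_act_extensive: "finite \<gamma> \<Longrightarrow> dominated \<gamma> (letter_act x \<gamma>)"
  by (simp add: dominated_def card_letter_act)

lemma letter_act_mono:
  assumes "finite \<gamma>" "finite \<delta>" "dominated \<gamma> \<delta>"
  shows "dominated (letter_act x \<gamma>) (letter_act x \<delta>)"
  unfolding dominated_def
proof
  fix z
  have "card {y \<in> \<gamma>. y < x} \<le> card {y \<in> \<delta>. y < x}"
    using assms by (rule dominated_strict)
  moreover have "card {y \<in> \<gamma>. y \<le> z} \<le> card {y \<in> \<delta>. y \<le> z}"
    using assms(3) by (simp add: dominated_def)
  ultimately show "card {y \<in> letter_act x \<gamma>. y \<le> z} \<le> card {y \<in> letter_act x \<delta>. y \<le> z}"
    using assms(1,2) by (auto simp: card_letter_act max_def)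
qed

section \<open>Action of words and fixed columns\<close>

lemma word_act_Cons: "word_act (x # w) \<gamma> = letter_act x (word_act w \<gamma>)"
  by (simp add: word_act_def)

lemma finite_word_act: "finite \<gamma> \<Longrightarrow> finite (word_act w \<gamma>)"
  by (induction w) (auto simp: word_act_Nil word_act_Cons finite_letter_act)

lemma word_act_extensive: "finite \<gamma> \<Longrightarrow> dominated \<gamma> (word_act w \<gamma>)"
proof (induction w)
  case Nil
  then show ?case by (simp add: word_act_Nil dominated_refl)
next
  case (Cons x w)
  then show ?case
    unfolding word_act_Cons
    using dominated_trans finite_word_act letter_act_extensive by blast
qed

lemma word_act_mono:
  assumes "finite \<gamma>" "finite \<delta>" "dominated \<gamma> \<delta>"
  shows "dominated (word_act w \<gamma>) (word_act w \<delta>)"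
  using assms
  by (induction w) (auto simp: word_act_Nil word_act_Cons finite_word_act letter_act_mono)

lemma word_act_fixed_iff:
  assumes "finite \<gamma>"
  shows "word_act w \<gamma> = \<gamma> \<longleftrightarrow> set w \<subseteq> \<gamma>"
proof (induction w)
  case Nil
  then show ?case by (simp add: word_act_Nil)
next
  case (Cons x w)
  show ?case
  proof
    assume fixed: "word_act (x # w) \<gamma> = \<gamma>"
    \<comment> \<open>Extensivity gives a chain from \<gamma> through
      \<open>word_act w \<gamma>\<close> back to \<gamma>, so antisymmetry collapses it and already
      \<open>w\<close> fixes \<gamma>.\<close>
    then have "dominated (word_act w \<gamma>) \<gamma>"
      using letter_act_extensive[OF finite_word_act[OF assms], of w x] by (simp add: word_act_Cons)
    then have "word_act w \<gamma> = \<gamma>"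
      using assms by (intro dominated_antisym finite_word_act word_act_extensive)
    moreover have "x \<in> \<gamma>"
      using fixed letter_in_letter_act by (metis word_act_Cons)
    ultimately show "set (x # w) \<subseteq> \<gamma>"
      using Cons.IH by simp
  next
    assume "set (x # w) \<subseteq> \<gamma>"
    then show "word_act (x # w) \<gamma> = \<gamma>"
      using Cons.IH assms by (simp add: word_act_Cons letter_act_fixed)
  qed
qed

text \<open>The last letter acts first, so the letters enter in increasing order. Each can bump only
  letters at least as large as itself, hence none that entered before it.\<close>

lemma set_subset_word_act_decreasing:
  assumes "finite \<gamma>" "sorted_wrt (>) w"
  shows "set w \<subseteq> word_act w \<gamma>"
  using assms(2)
proof (induction w)
  case Nil
  then show ?case by simp
next
  case (Cons x w)
  have "y \<in> letter_act x (word_act w \<gamma>)" if "y \<in> set w" for y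
    using Cons that by (intro letter_act_keeps_smaller finite_word_act assms(1)) auto
  then show ?case
    by (auto simp: word_act_Cons letter_in_letter_act)
qed

text \<open>Applying \<open>u\<close> to the inequality between \<gamma> and
  \<open>word_act v \<gamma>\<close> leaves the right side alone, as \<open>u\<close> fixes it. Used
  in both directions, this compares two closure operators with the same fixed points.\<close>

lemma word_act_dominated:
  assumes "finite \<gamma>" "set u \<subseteq> word_act v \<gamma>"
  shows "dominated (word_act u \<gamma>) (word_act v \<gamma>)"
proof -
  have "dominated (word_act u \<gamma>) (word_act u (word_act v \<gamma>))"
    using assms(1) by (simp add: finite_word_act word_act_extensive word_act_mono)
  also have "word_act u (word_act v \<gamma>) = word_act v \<gamma>"
    using assms by (simp add: finite_word_act word_act_fixed_iff)
  finally show ?thesis .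
qed

section \<open>Idempotents of the stylic monoid\<close>

context
  fixes A :: "'a::linorder set"
  assumes finite_A: "finite A"
begin

lemma finite_column: "\<gamma> \<in> columns A \<Longrightarrow> finite \<gamma>"
  by (auto simp: columns_def intro: finite_subset[OF _ finite_A])

lemma styl_map_eq_iff:
  "styl_map A u = styl_map A v \<longleftrightarrow> (\<forall>\<gamma>\<in>columns A. word_act u \<gamma> = word_act v \<gamma>)"
  unfolding styl_map_def by (metis restrict_apply' restrict_ext)

text \<open>Idempotence says that \<open>w\<close> fixes every column it produces; the criterion for
  fixed columns turns this into containment of the support.\<close>

lemma styl_map_idempotent_iff:
  assumes "w \<in> lists A"
  shows "styl_map A w \<in> idempotents (Styl A) \<longleftrightarrow> (\<forall>\<gamma>\<in>columns A. set w \<subseteq> word_act w \<gamma>)"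
proof -
  have "styl_map A w \<in> idempotents (Styl A) \<longleftrightarrow> styl_map A (w @ w) = styl_map A w"
    using assms by (simp add: idempotents_def carrier_Styl styl_map_append)
  also have "\<dots> \<longleftrightarrow> (\<forall>\<gamma>\<in>columns A. set w \<subseteq> word_act w \<gamma>)"
    by (simp add: styl_map_eq_iff word_act_append word_act_fixed_iff finite_word_act finite_column)
  finally show ?thesis .
qed

lemma idempotent_eqI:
  assumes "u \<in> lists A" "v \<in> lists A" "set u = set v"
    and "styl_map A u \<in> idempotents (Styl A)" "styl_map A v \<in> idempotents (Styl A)"
  shows "styl_map A u = styl_map A v"
  unfolding styl_map_eq_iff
proof
  fix \<gamma> assume \<gamma>: "\<gamma> \<in> columns A"
  then have "set u \<subseteq> word_act v \<gamma>" "set v \<subseteq> word_act u \<gamma>"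
    using assms by (auto simp: styl_map_idempotent_iff)
  then show "word_act u \<gamma> = word_act v \<gamma>"
    using finite_column[OF \<gamma>] by (intro dominated_antisym word_act_dominated finite_word_act)
qed

text \<open>Equal maps fix the same columns, and the support is the least fixed column. It suffices
  to test on the two supports themselves.\<close>

lemma set_eq_if_styl_map_eq:
  assumes "u \<in> lists A" "v \<in> lists A" "styl_map A u = styl_map A v"
  shows "set u = set v"
proof -
  have "set u \<subseteq> \<gamma> \<longleftrightarrow> set v \<subseteq> \<gamma>" if "\<gamma> \<in> columns A" for \<gamma>
    using assms(3) that finite_column[OF that] by (metis styl_map_eq_iff word_act_fixed_iff)
  from this[of "set u"] this[of "set v"] show ?thesis
    using assms(1,2) by (auto simp: columns_def)
qed

text \<open>This is the identification of columns with decreasing words. Surjectivity supplies a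
  decreasing word with any given support; injectivity serves the counting.\<close>

lemma bij_betw_set_decreasing_words:
  "bij_betw set {w \<in> lists A. sorted_wrt (>) w} (Pow A)"
proof (rule bij_betwI[where g = "\<lambda>D. rev (sorted_list_of_set D)"])
  show "set \<in> {w \<in> lists A. sorted_wrt (>) w} \<rightarrow> Pow A" by auto
  show "(\<lambda>D. rev (sorted_list_of_set D)) \<in> Pow A \<rightarrow> {w \<in> lists A. sorted_wrt (>) w}"
    by (auto simp: sorted_wrt_rev finite_subset[OF _ finite_A])
  fix w assume "w \<in> {w \<in> lists A. sorted_wrt (>) w}"
  then have "sorted_wrt (<) (rev w)" by (simp add: sorted_wrt_rev)
  then have "sorted_list_of_set (set (rev w)) = rev w"
    by (metis sorted_list_of_set.idem_if_sorted_distinct strict_sorted_iff)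
  then show "rev (sorted_list_of_set (set w)) = w" by simp
next
  fix D assume "D \<in> Pow A"
  then show "set (rev (sorted_list_of_set D)) = D"
    by (simp add: finite_subset[OF _ finite_A])
qed

lemma decreasing_idempotent:
  "w \<in> lists A \<Longrightarrow> sorted_wrt (>) w \<Longrightarrow> styl_map A w \<in> idempotents (Styl A)"
  by (simp add: styl_map_idempotent_iff set_subset_word_act_decreasing finite_column)

lemma idempotents_Styl:
  "idempotents (Styl A) = styl_map A ` {w \<in> lists A. sorted_wrt (>) w}"
proof (intro equalityI subsetI)
  fix e assume e: "e \<in> idempotents (Styl A)"
  then obtain w where w: "w \<in> lists A" "e = styl_map A w"
    by (auto simp: idempotents_def carrier_Styl)
  then have "set w \<in> set ` {w \<in> lists A. sorted_wrt (>) w}"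
    unfolding bij_betw_imp_surj_on[OF bij_betw_set_decreasing_words] by auto
  then obtain d where d: "d \<in> lists A" "sorted_wrt (>) d" "set d = set w"
    by auto
  have "styl_map A w = styl_map A d"
    using e w d decreasing_idempotent[OF d(1,2)] by (intro idempotent_eqI) simp_all
  with d w show "e \<in> styl_map A ` {w \<in> lists A. sorted_wrt (>) w}" by blast
qed (auto intro!: decreasing_idempotent)

lemma card_idempotents_Styl: "card (idempotents (Styl A)) = 2 ^ card A"
proof -
  \<comment> \<open>The map determines the support, and the support determines the decreasing
    word.\<close>
  have "inj_on (styl_map A) {w \<in> lists A. sorted_wrt (>) w}"
  proof (rule inj_onI)
    fix u v
    assume uv: "u \<in> {w \<in> lists A. sorted_wrt (>) w}" "v \<in> {w \<in> lists A. sorted_wrt (>) w}"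
      "styl_map A u = styl_map A v"
    then have "set u = set v"
      by (intro set_eq_if_styl_map_eq) simp_all
    then show "u = v"
      using uv by (intro inj_onD[OF bij_betw_imp_inj_on[OF bij_betw_set_decreasing_words]])
  qed
  then have "card (idempotents (Styl A)) = card {w \<in> lists A. sorted_wrt (>) w}"
    by (simp add: idempotents_Styl card_image)
  also have "\<dots> = card (Pow A)"
    by (rule bij_betw_same_card[OF bij_betw_set_decreasing_words])
  finally show ?thesis using finite_A by (simp add: card_Pow)
qed

end

theorem theorem12p1:
  fixes A :: "'a::linorder set"
  assumes "finite A"
  shows
    "(\<forall>w\<in>lists A. \<forall>\<gamma>\<in>columns A. word_act w \<gamma> = \<gamma> \<longleftrightarrow> set w \<subseteq> \<gamma>) \<and>
     (\<forall>w\<in>lists A.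
        set w \<in> {\<gamma> \<in> columns A. word_act w \<gamma> = \<gamma>} \<and>
        (\<forall>\<gamma>\<in>{\<gamma> \<in> columns A. word_act w \<gamma> = \<gamma>}. set w \<subseteq> \<gamma>)) \<and>
     idempotents (Styl A) = styl_map A ` {w \<in> lists A. sorted_wrt (>) w} \<and>
     card (idempotents (Styl A)) = 2 ^ card A"
proof -
  have fixed: "word_act w \<gamma> = \<gamma> \<longleftrightarrow> set w \<subseteq> \<gamma>" if "\<gamma> \<in> columns A" for w \<gamma>
    using assms that by (simp add: finite_column word_act_fixed_iff)
  \<comment> \<open>The support, now seen to be a column, can be put for \<gamma> in
    \<open>fixed\<close>: \<open>w\<close> fixes it.\<close>
  have "set w \<in> columns A" if "w \<in> lists A" for w
    using that by (auto simp: columns_def)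
  with fixed show ?thesis
    using idempotents_Styl[OF assms] card_idempotents_Styl[OF assms]
    by (intro conjI ballI) auto
qed

end
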